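(* Let $a=(x_a,y_a)\in\mathbb{R}^2$ and $b=(x_b,y_b)\in\mathbb{R}^2$ be two arbitrary patterns and let $\rho_a$ and $\rho_b$ be their respective density patterns. Then $$\overline{d}_{\mathrm{tr}}(\rho_a,\rho_b)=d_E(a,b),$$ where $\overline{d}_{\mathrm{tr}}$ is the normalized trace distance and $d_E$ is the Euclidean distance on $\mathbb{R}^2$.
   Context: A (two-feature) pattern is a point $\mathbf{x}=(x,y)\in\mathbb{R}^2$. Its density pattern is the $2\times 2$ complex matrix $$\rho_{\mathbf{x}}=\frac12\begin{pmatrix}1+r_3 & r_1-ir_2\\ r_1+ir_2 & 1-r_3\end{pmatrix}=\frac{1}{x^2+y^2+1}\begin{pmatrix}x^2+y^2 & x-iy\\ x+iy & 1\end{pmatrix},$$ where $$r_1=\frac{2x}{x^2+y^2+1},\quad r_2=\frac{2y}{x^2+y^2+1},\quad r_3=\frac{x^2+y^2-1}{x^2+y^2+1}$$ are called the Pauli components of $\rho_{\mathbf{x}}$ (i.e. $(r_1,r_2,r_3)$ is the image of $(x,y)$ under inverse stereographic projection from the north pole of the unit sphere). The trace distance is $d_{\mathrm{tr}}(\rho_a,\rho_b)=\frac12\sum_i|\lambda_i|$, where the $\lambda_i$ are the eigenvalues of $\rho_a-\rho_b$ (counted with multiplicity). The normalized trace distance between two density patterns $\rho_a,\rho_b$ is $$\overline{d}_{\mathrm{tr}}(\rho_a,\rho_b)=K_{a,b}\,d_{\mathrm{tr}}(\rho_a,\rho_b),\qquad K_{a,b}=\frac{2}{\sqrt{(1-r_{a_3})(1-r_{b_3})}},$$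 where $r_{a_3}$ and $r_{b_3}$ are the third Pauli components of $\rho_a$ and $\rho_b$, respectively. *)

theory Defs
  imports "HOL-Analysis.Product_Vector" "Jordan_Normal_Form.Spectral_Radius"
begin

text \<open>Patterns are points of \<^typ>\<open>real \<times> real\<close>, whose library metric \<^const>\<open>dist\<close> is the
  Euclidean one (see \<open>dist_Pair_Pair\<close>).\<close>

type_synonym pattern = "real \<times> real"

fun pauli1 :: "pattern \<Rightarrow> real" where
  "pauli1 (x, y) = 2 * x / (x\<^sup>2 + y\<^sup>2 + 1)"

fun pauli2 :: "pattern \<Rightarrow> real" where
  "pauli2 (x, y) = 2 * y / (x\<^sup>2 + y\<^sup>2 + 1)"

fun pauli3 :: "pattern \<Rightarrow> real" where
  "pauli3 (x, y) = (x\<^sup>2 + y\<^sup>2 - 1) / (x\<^sup>2 + y\<^sup>2 + 1)"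

definition pauli_matrix :: "real \<Rightarrow> real \<Rightarrow> real \<Rightarrow> complex mat" where
  "pauli_matrix r1 r2 r3 = (1 / 2) \<cdot>\<^sub>m mat_of_rows_list 2
     [[1 + complex_of_real r3, complex_of_real r1 - \<i> * complex_of_real r2],
      [complex_of_real r1 + \<i> * complex_of_real r2, 1 - complex_of_real r3]]"

definition density_pattern :: "pattern \<Rightarrow> complex mat" where
  "density_pattern p = pauli_matrix (pauli1 p) (pauli2 p) (pauli3 p)"

text \<open>The third Pauli component read off from the matrix itself, so that the normalized trace
  distance is a function of density matrices; junk outside the range of \<^const>\<open>pauli_matrix\<close>.\<close>

definition third_pauli :: "complex mat \<Rightarrow> real" where
  "third_pauli \<rho> = (THE r3. \<exists>r1 r2. \<rho> = pauli_matrix r1 r2 r3)"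

text \<open>Each eigenvalue is weighted by its algebraic multiplicity, i.e. its multiplicity as a root
  of the characteristic polynomial.\<close>

definition trace_distance :: "complex mat \<Rightarrow> complex mat \<Rightarrow> real" where
  "trace_distance A B =
     (1 / 2) * (\<Sum>k\<in>spectrum (A - B). real (order k (char_poly (A - B))) * cmod k)"

definition normalization :: "complex mat \<Rightarrow> complex mat \<Rightarrow> real" where
  "normalization A B = 2 / sqrt ((1 - third_pauli A) * (1 - third_pauli B))"

definition normalized_trace_distance :: "complex mat \<Rightarrow> complex mat \<Rightarrow> real" where
  "normalized_trace_distance A B = normalization A B * trace_distance A B"

lemma third_pauli_pauli_matrix [simp]: "third_pauli (pauli_matrix r1 r2 r3) = r3"
proof -
  have entry: "pauli_matrix u v w $$ (0, 0) = (1 + complex_of_real w) / 2" for u v w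
    by (simp add: pauli_matrix_def mat_of_rows_list_def)
  have "w = r3" if "pauli_matrix r1 r2 r3 = pauli_matrix u v w" for u v w
    using entry[of r1 r2 r3] entry[of u v w] that by simp
  then show ?thesis
    unfolding third_pauli_def by (intro the_equality) blast+
qed

lemma third_pauli_density_pattern: "third_pauli (density_pattern p) = pauli3 p"
  by (simp add: density_pattern_def)

lemma density_pattern_eq:
  "density_pattern (x, y) = complex_of_real (1 / (x\<^sup>2 + y\<^sup>2 + 1)) \<cdot>\<^sub>m mat_of_rows_list 2
     [[complex_of_real (x\<^sup>2 + y\<^sup>2), complex_of_real x - \<i> * complex_of_real y],
      [complex_of_real x + \<i> * complex_of_real y, 1]]"
proof -
  define s where "s = x\<^sup>2 + y\<^sup>2 + 1"
  have nz: "s \<noteq> 0"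
    unfolding s_def by (smt (verit) zero_le_power2)
  have sq: "x\<^sup>2 + y\<^sup>2 = s - 1"
    by (simp add: s_def)
  have p: "pauli1 (x, y) = 2 * x / s" "pauli2 (x, y) = 2 * y / s" "pauli3 (x, y) = (s - 2) / s"
    by (simp_all add: s_def)
  have z: "complex_of_real s \<noteq> 0"
    using nz by simp
  show ?thesis
    unfolding density_pattern_def pauli_matrix_def p sq
  proof (rule eq_matI, goal_cases)
    case (1 i j)
    then have "i = 0 \<or> i = 1" "j = 0 \<or> j = 1"
      by (auto simp: mat_of_rows_list_def)
    then show ?case
      using z by (auto simp: mat_of_rows_list_def divide_simps)
  qed (simp_all add: mat_of_rows_list_def)
qed

end

theory Submission
  imports Defs
begin

text \<open>A difference of two Pauli matrices is half a traceless Hermitian matrix with Pauli vector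
  \<open>d\<close>, whose eigenvalues are \<open>\<plusminus>\<bar>d\<bar> / 2\<close>; so the trace distance is half the chordal distance of the
  points on the unit sphere. Inverse stereographic projection is conformal: with
  \<open>s\<^sub>p = \<bar>p\<bar>\<^sup>2 + 1\<close>, the chord between the images of \<open>a\<close> and \<open>b\<close> has length
  \<open>2 \<bar>a - b\<bar> / sqrt (s\<^sub>a s\<^sub>b)\<close>, and since \<open>1 - r\<^sub>3 = 2 / s\<close>, the normalization cancels this factor.\<close>

lemma det_2:
  fixes A :: "'a :: comm_ring_1 mat"
  assumes "A \<in> carrier_mat 2 2"
  shows "det A = A $$ (0, 0) * A $$ (1, 1) - A $$ (0, 1) * A $$ (1, 0)"
  using assms
  by (subst laplace_expansion_row[OF assms, of 0])
    (simp_all add: numeral_2_eq_2 cofactor_def det_single mat_delete_def)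

lemma char_poly_2:
  fixes A :: "'a :: comm_ring_1 mat"
  assumes "A \<in> carrier_mat 2 2"
  shows "char_poly A =
    [:- A $$ (0, 0), 1:] * [:- A $$ (1, 1), 1:] - [:- A $$ (0, 1):] * [:- A $$ (1, 0):]"
  using assms unfolding char_poly_def
  by (subst det_2) (auto simp: char_poly_matrix_def)

lemma pauli_matrix_carrier [simp]: "pauli_matrix r1 r2 r3 \<in> carrier_mat 2 2"
  by (rule carrier_matI) (simp_all add: pauli_matrix_def mat_of_rows_list_def)

text \<open>The diagonal entries are opposite, so the linear coefficient vanishes. The off-diagonal
  entries are conjugate, so their product is a squared modulus and the determinant is
  \<open>- (t * t)\<close>.\<close>

lemma char_poly_pauli_matrix_diff:
  fixes u1 u2 u3 v1 v2 v3 :: real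
  defines "t \<equiv> complex_of_real (sqrt ((u1 - v1)\<^sup>2 + (u2 - v2)\<^sup>2 + (u3 - v3)\<^sup>2) / 2)"
  shows "char_poly (pauli_matrix u1 u2 u3 - pauli_matrix v1 v2 v3) = [:- t, 1:] * [:t, 1:]"
proof -
  let ?D = "pauli_matrix u1 u2 u3 - pauli_matrix v1 v2 v3"
  have D: "?D \<in> carrier_mat 2 2"
    by (intro minus_carrier_mat pauli_matrix_carrier)
  have entries:
    "?D $$ (0, 0) = complex_of_real ((u3 - v3) / 2)"
    "?D $$ (0, 1) = Complex ((u1 - v1) / 2) (- (u2 - v2) / 2)"
    "?D $$ (1, 0) = Complex ((u1 - v1) / 2) ((u2 - v2) / 2)"
    "?D $$ (1, 1) = complex_of_real (- (u3 - v3) / 2)"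
    by (simp_all add: pauli_matrix_def mat_of_rows_list_def complex_eq_iff field_simps)
  have t2: "t * t = complex_of_real (((u1 - v1)\<^sup>2 + (u2 - v2)\<^sup>2 + (u3 - v3)\<^sup>2) / 4)"
    unfolding t_def of_real_mult[symmetric] by (simp add: power2_eq_square[symmetric] power_divide del: of_real_divide of_real_power)
  have "char_poly ?D =
      [:- ?D $$ (0, 0), 1:] * [:- ?D $$ (1, 1), 1:] - [:- ?D $$ (0, 1):] * [:- ?D $$ (1, 0):]"
    by (rule char_poly_2[OF D])
  also have "\<dots> = [:- (t * t), 0, 1:]"
    unfolding t2 entries by (simp add: complex_eq_iff power2_eq_square field_simps)
  finally show ?thesis
    by simp
qed

lemma trace_distance_pauli_matrix:
  "trace_distance (pauli_matrix u1 u2 u3) (pauli_matrix v1 v2 v3) =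
     sqrt ((u1 - v1)\<^sup>2 + (u2 - v2)\<^sup>2 + (u3 - v3)\<^sup>2) / 2"
proof -
  let ?D = "pauli_matrix u1 u2 u3 - pauli_matrix v1 v2 v3"
  define r where "r = sqrt ((u1 - v1)\<^sup>2 + (u2 - v2)\<^sup>2 + (u3 - v3)\<^sup>2) / 2"
  define t where "t = complex_of_real r"
  have D: "?D \<in> carrier_mat 2 2"
    by (intro minus_carrier_mat pauli_matrix_carrier)
  have cp: "char_poly ?D = [:- t, 1:] * [:t, 1:]"
    unfolding t_def r_def by (rule char_poly_pauli_matrix_diff)
  \<comment> \<open>Keeping the product of linear factors unexpanded lets the roots be read
    off.\<close>
  have spec: "spectrum ?D = {t, - t}"
    unfolding spectrum_def eigenvalue_root_char_poly[OF D] cp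
    by (auto simp: poly_mult add_eq_0_iff2 simp del: mult_pCons_left mult_pCons_right)
  have norm_t: "cmod t = r"
    by (simp add: t_def r_def)
  have "(\<Sum>k\<in>{t, - t}. real (order k ([:- t, 1:] * [:t, 1:])) * cmod k) = 2 * r"
  \<comment> \<open>For \<open>t = 0\<close> the set \<open>{t, - t}\<close> is a singleton with a
    double root, but its weight \<open>cmod t\<close> is zero. Otherwise there are two simple roots,
    each contributing \<open>r\<close>.\<close>
  proof (cases "t = 0")
    case True
    then show ?thesis using norm_t by simp
  next
    case False
    have "order k ([:- t, 1:] * [:t, 1:]) = order k [:- t, 1:] + order k [:t, 1:]" for k
      by (rule order_mult) (simp only: mult_eq_0_iff, simp)
    with False norm_t show ?thesis
      by (simp add: order_linear' del: mult_pCons_left mult_pCons_right)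
  qed
  then show ?thesis
    unfolding trace_distance_def spec cp by (simp add: r_def)
qed

lemma one_minus_pauli3: "1 - pauli3 (x, y) = 2 / (x\<^sup>2 + y\<^sup>2 + 1)"
proof -
  have "x\<^sup>2 + y\<^sup>2 + 1 \<noteq> 0"
    by (smt (verit) zero_le_power2)
  then show ?thesis by (simp add: field_simps)
qed

lemma pauli_chord:
  "(pauli1 (x, y) - pauli1 (u, v))\<^sup>2 + (pauli2 (x, y) - pauli2 (u, v))\<^sup>2
     + (pauli3 (x, y) - pauli3 (u, v))\<^sup>2
   = 4 * ((x - u)\<^sup>2 + (y - v)\<^sup>2) / ((x\<^sup>2 + y\<^sup>2 + 1) * (u\<^sup>2 + v\<^sup>2 + 1))"
proof -
  define s where "s = x\<^sup>2 + y\<^sup>2 + 1"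
  define w where "w = u\<^sup>2 + v\<^sup>2 + 1"
  have nz: "s \<noteq> 0" "w \<noteq> 0"
    unfolding s_def w_def by (smt (verit) zero_le_power2)+
  \<comment> \<open>Writing the third component as \<open>1 - 2 / s\<close> turns its contribution
    over the common denominator into \<open>(s - w)\<^sup>2\<close>.\<close>
  have p3: "pauli3 (x, y) - pauli3 (u, v) = 2 / w - 2 / s"
    using one_minus_pauli3[of x y] one_minus_pauli3[of u v] by (simp add: s_def w_def)
  have p12: "pauli1 (x, y) - pauli1 (u, v) = 2 * x / s - 2 * u / w"
    "pauli2 (x, y) - pauli2 (u, v) = 2 * y / s - 2 * v / w"
    by (simp_all add: s_def w_def)
  have "(2 * x / s - 2 * u / w)\<^sup>2 + (2 * y / s - 2 * v / w)\<^sup>2 + (2 / w - 2 / s)\<^sup>2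
      = 4 * ((x * w - u * s)\<^sup>2 + (y * w - v * s)\<^sup>2 + (s - w)\<^sup>2) / (s * w)\<^sup>2"
    using nz by (simp add: field_simps power2_eq_square)
  \<comment> \<open>Collecting squares gives \<open>w\<^sup>2 * s + s\<^sup>2 * w - 2 * s * w * (x *
    u + y * v + 1)\<close>. Now factor out \<open>s * w\<close> and use that
    \<open>s + w - 2\<close> is the sum of the squared norms of the two points.\<close>
  also have "(x * w - u * s)\<^sup>2 + (y * w - v * s)\<^sup>2 + (s - w)\<^sup>2 = s * w * ((x - u)\<^sup>2 + (y - v)\<^sup>2)"
    unfolding s_def w_def by (simp add: algebra_simps power2_eq_square)
  also have "4 * (s * w * ((x - u)\<^sup>2 + (y - v)\<^sup>2)) / (s * w)\<^sup>2
      = 4 * ((x - u)\<^sup>2 + (y - v)\<^sup>2) / (s * w)"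
    using nz by (simp add: power2_eq_square)
  finally show ?thesis
    unfolding p12 p3 by (simp only: s_def w_def)
qed

theorem proposition1:
  fixes a b :: pattern
  shows "normalized_trace_distance (density_pattern a) (density_pattern b) = dist a b"
proof -
  obtain x y u v where ab: "a = (x, y)" "b = (u, v)"
    by (cases a, cases b)
  define S where "S = (x\<^sup>2 + y\<^sup>2 + 1) * (u\<^sup>2 + v\<^sup>2 + 1)"
  have S: "S > 0"
    unfolding S_def by (intro mult_pos_pos add_nonneg_pos) auto
  \<comment> \<open>\<open>pauli3\<close> stays folded so that \<open>one_minus_pauli3\<close> can
    rewrite both factors.\<close>
  have "normalization (density_pattern a) (density_pattern b) = 2 / sqrt (4 / S)"
    by (simp add: normalization_def third_pauli_density_pattern ab one_minus_pauli3 S_def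
        del: pauli3.simps)
  also have "\<dots> = sqrt S"
    using S by (simp add: real_sqrt_divide)
  finally have K: "normalization (density_pattern a) (density_pattern b) = sqrt S" .
  have "trace_distance (density_pattern a) (density_pattern b)
      = sqrt (4 * ((x - u)\<^sup>2 + (y - v)\<^sup>2) / S) / 2"
    unfolding density_pattern_def trace_distance_pauli_matrix ab pauli_chord S_def ..
  also have "\<dots> = sqrt ((x - u)\<^sup>2 + (y - v)\<^sup>2) / sqrt S"
    unfolding real_sqrt_divide real_sqrt_mult by simp
  finally show ?thesis
    unfolding normalized_trace_distance_def K
    using S by (simp add: ab dist_Pair_Pair dist_real_def)
qed

end
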